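(* No quiver in the mutation class of $E_8^{(1,1)}$ has an admissible vector.
   Context: $E_8^{(1,1)}$ is the exceptional mutation-finite quiver (in the classification of Felikson–Shapiro–Tumarkin / Derksen–Owen) given by: vertices $a,b$ with a double arrow $a\Rightarrow b$; three vertices $x_1,x_2,x_3$, each with arrows $b\to x_i$ and $x_i\to a$; and pendant paths (single arrows, any orientation) attached at the $x_i$ so that the three "legs" starting at $x_1,x_2,x_3$ have $2,1,5$ vertices respectively (10 vertices in total). Quivers have no loops/2-cycles; $b_{ij}$ is the number of arrows $v_i\to v_j$ (negative if reversed); mutation $\mu_k$: $b'_{ij}=-b_{ij}$ if $k\in\{i,j\}$, else $b'_{ij}=b_{ij}+\mathrm{sgn}(b_{ik})[b_{ik}b_{kj}]_+$. For a quiver $Q$ on mutable vertices $v_1,\dots,v_n$ and $\boldsymbol b\in\mathbb Z^n$, add a frozen vertex $q$ with $b_i$ arrows from $v_i$ to $q$; mutations only at mutable vertices. $\boldsymbol b$ is admissible if $\boldsymbol b\neq0$ and the resulting quiver with frozen vertex has finite mutation class. *)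

theory Defs
  imports Main
begin

text \<open>
  A matrix \<open>Q :: 'v \<Rightarrow> 'v \<Rightarrow> int\<close> represents a quiver on the vertex set \<open>'v\<close>: \<open>Q u v\<close> is the
  number of arrows \<open>u \<rightarrow> v\<close>, counted negatively if the arrows go from \<open>v\<close> to \<open>u\<close>. Skew-symmetry
  encodes the absence of loops and 2-cycles.
\<close>

type_synonym 'v quiver = "'v \<Rightarrow> 'v \<Rightarrow> int"

definition is_quiver :: "'v quiver \<Rightarrow> bool" where
  "is_quiver Q \<longleftrightarrow> (\<forall>u v. Q u v = - Q v u)"

definition mutate :: "'v \<Rightarrow> 'v quiver \<Rightarrow> 'v quiver" where
  "mutate k Q = (\<lambda>i j. if k = i \<or> k = j then - Q i j
                      else Q i j + sgn (Q i k) * max 0 (Q i k * Q k j))"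

text \<open>The vertices in \<open>M\<close> are the mutable ones. Vertices stay labelled; on a finite vertex set
  this class is finite iff it is finite up to isomorphism.\<close>

inductive_set mutation_class :: "'v set \<Rightarrow> 'v quiver \<Rightarrow> 'v quiver set"
  for M :: "'v set" and Q :: "'v quiver" where
  base: "Q \<in> mutation_class M Q"
| step: "R \<in> mutation_class M Q \<Longrightarrow> k \<in> M \<Longrightarrow> mutate k R \<in> mutation_class M Q"

text \<open>The frozen vertex is \<open>None\<close>.\<close>

definition add_frozen :: "'v quiver \<Rightarrow> ('v \<Rightarrow> int) \<Rightarrow> 'v option quiver" where
  "add_frozen Q b = (\<lambda>s t. case (s, t) of
       (Some i, Some j) \<Rightarrow> Q i j
     | (Some i, None) \<Rightarrow> b i
     | (None, Some j) \<Rightarrow> - b j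
     | (None, None) \<Rightarrow> 0)"

definition admissible :: "'v::finite quiver \<Rightarrow> ('v \<Rightarrow> int) \<Rightarrow> bool" where
  "admissible Q b \<longleftrightarrow>
     (\<exists>i. b i \<noteq> 0) \<and> finite (mutation_class (range Some) (add_frozen Q b))"

text \<open>Legs: \<open>x1, y2\<close>; \<open>x2\<close>; \<open>x3, z2, z3, z4, z5\<close>. Absolute values leave the orientation of the
  pendant paths free.\<close>

definition is_E8_11 :: "'v::finite quiver \<Rightarrow> bool" where
  "is_E8_11 Q \<longleftrightarrow> is_quiver Q \<and>
     (\<exists>a b x1 y2 x2 x3 z2 z3 z4 z5.
        distinct [a, b, x1, y2, x2, x3, z2, z3, z4, z5] \<and>
        UNIV = {a, b, x1, y2, x2, x3, z2, z3, z4, z5} \<and>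
        Q a b = 2 \<and>
        Q b x1 = 1 \<and> Q x1 a = 1 \<and>
        Q b x2 = 1 \<and> Q x2 a = 1 \<and>
        Q b x3 = 1 \<and> Q x3 a = 1 \<and>
        \<bar>Q x1 y2\<bar> = 1 \<and>
        \<bar>Q x3 z2\<bar> = 1 \<and> \<bar>Q z2 z3\<bar> = 1 \<and> \<bar>Q z3 z4\<bar> = 1 \<and> \<bar>Q z4 z5\<bar> = 1 \<and>
        (\<forall>u v. Q u v \<noteq> 0 \<longrightarrow>
           {u, v} \<in> {{a, b}, {b, x1}, {x1, a}, {b, x2}, {x2, a}, {b, x3}, {x3, a},
                     {x1, y2}, {x3, z2}, {z2, z3}, {z3, z4}, {z4, z5}}))"

end

theory Submission
  imports Defs "HOL-Library.Lattice_Algebras"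
begin

text \<open>
  Treat the frozen vertex as a vertex \<open>q\<close> of a larger quiver that is never mutated. If the mutation
  class of that quiver is finite, then at a double arrow \<open>u \<Rightarrow> v\<close> of mutable vertices the arrows to
  \<open>q\<close> satisfy \<open>Q u q + Q v q = 0\<close> and \<open>Q v q \<ge> 0\<close>: otherwise mutating alternately at \<open>u\<close> and \<open>v\<close>
  makes their numbers grow without bound. Heuristically, in the language of tubular weighted
  projective lines, a double arrow singles out a slope, and its condition selects the vectors
  concentrated in that slope. A word of 14 mutations leads from the double arrow \<open>a \<Rightarrow> b\<close> to a
  double arrow of another slope, and the two conditions together force \<open>q\<close> to be isolated: the
  second one bounds a sum of nonnegative terms by zero.
\<close>

subsection \<open>Mutation\<close>

definition path_arrows :: "int \<Rightarrow> int \<Rightarrow> int" where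
  "path_arrows m n = sgn m * max 0 (m * n)"

lemma mutate_eq:
  "mutate k Q i j =
     (if k = i \<or> k = j then - Q i j else Q i j + path_arrows (Q i k) (Q k j))"
  by (simp add: mutate_def path_arrows_def)

lemma path_arrows_prts: "path_arrows m n = pprt m * pprt n - nprt m * nprt n"
  by (cases m "0 :: int" rule: linorder_cases; cases n "0 :: int" rule: linorder_cases)
    (simp_all add: path_arrows_def max_def zero_le_mult_iff)

lemma path_arrows_commute: "path_arrows m n = path_arrows n m"
  by (simp add: path_arrows_prts mult.commute)

lemma path_arrows_minus_minus: "path_arrows (- m) (- n) = - path_arrows m n"
  by (simp add: path_arrows_prts pprt_neg nprt_neg)

lemma path_arrows_simps [simp]:
  "path_arrows 0 n = 0" "path_arrows m 0 = 0"
  "path_arrows 1 n = pprt n" "path_arrows (- 1) n = nprt n"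
  by (simp_all add: path_arrows_prts)

lemma is_quiverI: "(\<And>u v. Q u v = - Q v u) \<Longrightarrow> is_quiver Q"
  unfolding is_quiver_def by blast

lemma is_quiver_swap: "is_quiver Q \<Longrightarrow> Q v u = - Q u v"
  unfolding is_quiver_def by blast

lemma is_quiver_diag [simp]: "is_quiver Q \<Longrightarrow> Q u u = 0"
  using is_quiver_swap[of Q u u] by simp

lemma is_quiver_uminus:
  assumes "is_quiver Q"
  shows "is_quiver (- Q)"
proof (rule is_quiverI)
  show "(- Q) u v = - (- Q) v u" for u v
    using is_quiver_swap[OF assms, of u v] by simp
qed

lemma is_quiver_mutate:
  assumes "is_quiver Q"
  shows "is_quiver (mutate k Q)"
proof (rule is_quiverI)
  show "mutate k Q u v = - mutate k Q v u" for u v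
    by (simp add: mutate_eq is_quiver_swap[OF assms, of v u] is_quiver_swap[OF assms, of k u]
        is_quiver_swap[OF assms, of v k] path_arrows_minus_minus path_arrows_commute)
qed

lemma mutate_mutate:
  assumes "is_quiver Q"
  shows "mutate k (mutate k Q) = Q"
  using assms by (auto simp: mutate_def fun_eq_iff)

lemma mutate_uminus: "mutate k (- Q) = - mutate k Q"
  by (simp add: mutate_eq fun_eq_iff path_arrows_minus_minus)

lemma is_quiver_mutation_class:
  assumes "R \<in> mutation_class M Q" "is_quiver Q"
  shows "is_quiver R"
  using assms by induction (simp_all add: is_quiver_mutate)

lemma mutate_in_mutation_class: "k \<in> M \<Longrightarrow> mutate k Q \<in> mutation_class M Q"
  by (intro mutation_class.intros)

lemma mutation_class_trans:
  assumes "S \<in> mutation_class M R" "R \<in> mutation_class M Q"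
  shows "S \<in> mutation_class M Q"
  using assms by induction (auto intro: mutation_class.step)

lemma mutation_class_sym:
  assumes "R \<in> mutation_class M Q" "is_quiver Q"
  shows "Q \<in> mutation_class M R"
  using assms
proof induction
  case (step R k)
  then have "R \<in> mutation_class M (mutate k R)"
    using mutate_in_mutation_class[of k M "mutate k R"]
    by (simp add: mutate_mutate is_quiver_mutation_class)
  then show ?case
    using step mutation_class_trans by blast
qed (rule mutation_class.base)

lemma finite_mutation_class_trans:
  assumes "R \<in> mutation_class M Q" "finite (mutation_class M Q)"
  shows "finite (mutation_class M R)"
  using assms mutation_class_trans by (metis finite_subset subsetI)

lemma uminus_in_mutation_class:
  assumes "R \<in> mutation_class M Q"
  shows "- R \<in> mutation_class M (- Q)"
  using assms
proof induction
  case (step R k)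
  then show ?case
    using mutation_class.step by (metis mutate_uminus)
qed (rule mutation_class.base)

lemma finite_mutation_class_uminus:
  assumes "finite (mutation_class M Q)"
  shows "finite (mutation_class M (- Q))"
proof (rule finite_subset)
  have uminus: "- (- R) = R" for R :: "'a quiver"
    by (simp add: fun_eq_iff)
  show "mutation_class M (- Q) \<subseteq> uminus ` mutation_class M Q"
    using uminus_in_mutation_class[of _ M "- Q"] uminus by (metis image_eqI subsetI)
qed (simp add: assms)

lemma isolated_mutation_class:
  assumes "R \<in> mutation_class M Q" "q \<notin> M" "\<And>u. u \<in> M \<Longrightarrow> Q u q = 0" "u \<in> M"
  shows "R u q = 0"
  using assms by (induction arbitrary: u) (auto simp: mutate_eq)

subsection \<open>Double arrows\<close>

lemma mutate_double_arrow:
  assumes "is_quiver Q" "Q u v = 2"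
  shows "mutate u Q v u = 2"
  using is_quiver_swap[OF assms(1), of v u] assms(2) by (simp add: mutate_eq)

lemma mutate_double_arrow_outside:
  assumes "is_quiver Q" "Q u v = 2" "q \<notin> {u, v}"
  shows "mutate u Q u q = - Q u q" "mutate u Q v q = Q v q + 2 * nprt (Q u q)"
proof -
  have "Q v u = - 2"
    using is_quiver_swap[OF assms(1), of v u] assms(2) by simp
  moreover from this have "u \<noteq> v"
    using assms(2) by auto
  ultimately show "mutate u Q u q = - Q u q" "mutate u Q v q = Q v q + 2 * nprt (Q u q)"
    using assms(3) by (auto simp: mutate_eq path_arrows_prts)
qed

text \<open>Mutating at \<open>u\<close> preserves the sum \<open>s = Q u q + Q v q\<close> and makes \<open>v\<close> the source of the double
  arrow, with \<open>Q u q + s\<close> arrows to \<open>q\<close>.\<close>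

lemma double_arrow_descent:
  assumes "is_quiver Q" "u \<in> M" "v \<in> M" "q \<notin> {u, v}" "Q u v = 2"
    and "Q u q \<le> 0" "Q u q + Q v q < 0"
  shows "\<exists>R \<in> mutation_class M Q. \<exists>w \<in> {u, v}. R w q \<le> Q u q - int n"
  using assms
proof (induction n arbitrary: Q u v)
  case 0
  then show ?case
    using mutation_class.base by force
next
  case (Suc n)
  note arrows = mutate_double_arrow[OF Suc.prems(1,5)]
    mutate_double_arrow_outside[OF Suc.prems(1,5,4)]
  let ?Q = "mutate u Q"
  have "\<exists>R \<in> mutation_class M ?Q. \<exists>w \<in> {v, u}. R w q \<le> ?Q v q - int n"
    by (rule Suc.IH) (use Suc.prems arrows in \<open>auto simp: is_quiver_mutate\<close>)
  then obtain R w where R: "R \<in> mutation_class M ?Q" "w \<in> {u, v}" "R w q \<le> ?Q v q - int n"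
    by blast
  moreover have "?Q v q \<le> Q u q - 1"
    using Suc.prems arrows by auto
  ultimately have "R w q \<le> Q u q - int (Suc n)"
    by linarith
  then show ?case
    using R mutation_class_trans mutate_in_mutation_class[OF Suc.prems(2)] by blast
qed

lemma double_arrow_infinite:
  assumes "is_quiver Q" "u \<in> M" "v \<in> M" "q \<notin> {u, v}" "Q u v = 2"
    and "Q u q \<le> 0" "Q u q + Q v q < 0"
  shows "infinite (mutation_class M Q)"
proof
  assume "finite (mutation_class M Q)"
  define X where "X = (\<lambda>(R, w). R w q) ` (mutation_class M Q \<times> {u, v})"
  have "finite X"
    unfolding X_def using \<open>finite (mutation_class M Q)\<close> by simp
  then have lower: "Min X \<le> R w q" if "R \<in> mutation_class M Q" "w \<in> {u, v}" for R w
    using that by (intro Min_le) (auto simp: X_def)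
  obtain R w where "R \<in> mutation_class M Q" "w \<in> {u, v}"
    "R w q \<le> Q u q - int (nat (Q u q - Min X + 1))"
    using double_arrow_descent[OF assms] by blast
  then show False
    using lower[of R w] by linarith
qed

lemma double_arrow_sum_nonneg:
  assumes Q: "is_quiver Q" "finite (mutation_class M Q)"
    and uv: "u \<in> M" "v \<in> M" "q \<notin> {u, v}" "Q u v = 2"
  shows "0 \<le> Q u q + Q v q"
proof (rule ccontr)
  assume neg: "\<not> 0 \<le> Q u q + Q v q"
  show False
  proof (cases "Q u q \<le> 0")
    case True
    then show False
      using double_arrow_infinite[OF Q(1) uv] neg Q(2) by simp
  next
    case False
    then have "infinite (mutation_class M (mutate u Q))"
      using neg uv mutate_double_arrow[OF Q(1) uv(4)] mutate_double_arrow_outside[OF Q(1) uv(4,3)]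
      by (intro double_arrow_infinite[of _ v M u q]) (auto simp: is_quiver_mutate Q(1))
    then show False
      using finite_mutation_class_trans[OF mutate_in_mutation_class[OF uv(1)] Q(2)] by simp
  qed
qed

proposition double_arrow_balanced:
  assumes Q: "is_quiver Q" and fin: "finite (mutation_class M Q)"
    and uv: "u \<in> M" "v \<in> M" "q \<notin> {u, v}" "Q u v = 2"
  shows "Q u q + Q v q = 0" "0 \<le> Q v q"
proof -
  have "Q v u = - 2"
    using is_quiver_swap[OF Q, of v u] uv(4) by simp
  then have "0 \<le> (- Q) v q + (- Q) u q"
    by (intro double_arrow_sum_nonneg[OF is_quiver_uminus[OF Q]
          finite_mutation_class_uminus[OF fin]])
      (use uv in simp_all)
  then show sum: "Q u q + Q v q = 0"
    using double_arrow_sum_nonneg[OF Q fin uv] by simp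
  have "finite (mutation_class M (mutate u Q))"
    by (rule finite_mutation_class_trans[OF mutate_in_mutation_class[OF uv(1)] fin])
  then have "0 \<le> mutate u Q v q + mutate u Q u q"
    by (rule double_arrow_sum_nonneg[OF is_quiver_mutate[OF Q]])
      (use uv in \<open>simp_all add: mutate_double_arrow[OF Q]\<close>)
  then have "0 \<le> Q v q + 2 * nprt (Q u q) - Q u q"
    by (simp add: mutate_double_arrow_outside[OF Q uv(4,3)])
  then show "0 \<le> Q v q"
    using sum nprt_le_zero[of "Q u q"] by linarith
qed

subsection \<open>Exchange matrices\<close>

definition exchange_matrix :: "'v list \<Rightarrow> 'v quiver \<Rightarrow> int list list" where
  "exchange_matrix vs Q = map (\<lambda>u. map (Q u) vs) vs"

lemma double_arrow_balanced_nth: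
  assumes "is_quiver Q" "finite (mutation_class (set vs) Q)" "q \<notin> set vs"
    and ij: "i < length vs" "j < length vs" "exchange_matrix vs Q ! i ! j = 2"
  shows "Q (vs ! i) q + Q (vs ! j) q = 0" "0 \<le> Q (vs ! j) q"
proof -
  have arrow: "Q (vs ! i) (vs ! j) = 2"
    using ij by (simp add: exchange_matrix_def)
  have q: "q \<notin> {vs ! i, vs ! j}"
    using ij assms(3) by auto
  show "Q (vs ! i) q + Q (vs ! j) q = 0" "0 \<le> Q (vs ! j) q"
    by (rule double_arrow_balanced[OF assms(1,2) nth_mem[OF ij(1)] nth_mem[OF ij(2)] q arrow])+
qed

definition mutate_matrix :: "nat \<Rightarrow> int list list \<Rightarrow> int list list" where
  "mutate_matrix k A =
     (map (\<lambda>r. (map2 (\<lambda>m n. m + path_arrows (r ! k) n) r (A ! k))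
       [k := - (r ! k)]) A) [k := map uminus (A ! k)]"

text \<open>\<open>c\<close> is the \<open>k\<close>-th column of the exchange matrix, and \<open>x\<close> lists the numbers of arrows to a
  further vertex, of which \<open>y\<close> belongs to the mutated one.\<close>

definition mutate_arrows :: "nat \<Rightarrow> int list \<Rightarrow> int \<Rightarrow> int list \<Rightarrow> int list" where
  "mutate_arrows k c y x = (map2 (\<lambda>m n. n + path_arrows m y) c x)[k := - y]"

lemma exchange_matrix_mutate:
  assumes "distinct vs" "k < length vs"
  shows "exchange_matrix vs (mutate (vs ! k) Q) = mutate_matrix k (exchange_matrix vs Q)"
  using assms
  by (intro nth_equalityI)
    (auto simp: exchange_matrix_def mutate_matrix_def mutate_eq nth_list_update nth_eq_iff_index_eq)

lemma map_mutate_arrows: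
  assumes "distinct vs" "k < length vs" "q \<notin> set vs"
  shows "map (\<lambda>u. mutate (vs ! k) Q u q) vs =
    mutate_arrows k (map (\<lambda>r. r ! k) (exchange_matrix vs Q)) (Q (vs ! k) q) (map (\<lambda>u. Q u q) vs)"
  using assms
  by (intro nth_equalityI)
    (auto simp: exchange_matrix_def mutate_arrows_def mutate_eq nth_list_update nth_eq_iff_index_eq)

definition mutate_word :: "'v list \<Rightarrow> nat list \<Rightarrow> 'v quiver \<Rightarrow> 'v quiver" where
  "mutate_word vs ks = fold (\<lambda>k. mutate (vs ! k)) ks"

lemma exchange_matrix_mutate_word:
  assumes "distinct vs" "set ks \<subseteq> {..<length vs}"
  shows "exchange_matrix vs (mutate_word vs ks Q) = fold mutate_matrix ks (exchange_matrix vs Q)"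
  using assms
  by (induction ks arbitrary: Q) (simp_all add: mutate_word_def exchange_matrix_mutate)

lemma mutate_word_in_mutation_class:
  assumes "set ks \<subseteq> {..<length vs}"
  shows "mutate_word vs ks Q \<in> mutation_class (set vs) Q"
  using assms
proof (induction ks rule: rev_induct)
  case Nil
  then show ?case
    by (simp add: mutate_word_def mutation_class.base)
next
  case (snoc k ks)
  then show ?case
    by (simp add: mutate_word_def mutation_class.step)
qed

fun mutation_columns :: "nat list \<Rightarrow> int list list \<Rightarrow> (nat \<times> int list) list" where
  "mutation_columns [] A = []"
| "mutation_columns (k # ks) A = (k, map (\<lambda>r. r ! k) A) # mutation_columns ks (mutate_matrix k A)"

text \<open>\<open>ys\<close> lists, for each mutation, the number of arrows from the mutated vertex to the further
  vertex. Naming these numbers keeps the later ones linear in their positive and negative parts.\<close>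

fun arrow_trace :: "(nat \<times> int list) list \<Rightarrow> int list \<Rightarrow> int list \<Rightarrow> int list \<Rightarrow> bool" where
  "arrow_trace [] x [] z \<longleftrightarrow> z = x"
| "arrow_trace ((k, c) # cs) x (y # ys) z \<longleftrightarrow>
     y = x ! k \<and> arrow_trace cs (mutate_arrows k c y x) ys z"
| "arrow_trace _ _ _ _ \<longleftrightarrow> False"

lemma arrow_trace_mutate_word:
  assumes "distinct vs" "set ks \<subseteq> {..<length vs}" "q \<notin> set vs"
  shows "\<exists>ys. length ys = length ks \<and> arrow_trace (mutation_columns ks (exchange_matrix vs Q))
    (map (\<lambda>u. Q u q) vs) ys (map (\<lambda>u. mutate_word vs ks Q u q) vs)"
  using assms
proof (induction ks arbitrary: Q)
  case Nil
  then show ?case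
    by (simp add: mutate_word_def)
next
  case (Cons k ks)
  let ?Q = "mutate (vs ! k) Q"
  have k: "k < length vs"
    using Cons.prems(2) by simp
  obtain ys where "length ys = length ks" "arrow_trace (mutation_columns ks (exchange_matrix vs ?Q))
    (map (\<lambda>u. ?Q u q) vs) ys (map (\<lambda>u. mutate_word vs ks ?Q u q) vs)"
    using Cons.IH[of ?Q] Cons.prems by auto
  then show ?case
    using k Cons.prems
    by (intro exI[of _ "Q (vs ! k) q # ys"])
      (simp add: mutate_word_def exchange_matrix_mutate map_mutate_arrows)
qed

subsection \<open>The frozen vertex\<close>

lemma is_quiver_add_frozen:
  assumes "is_quiver Q"
  shows "is_quiver (add_frozen Q b)"
proof (rule is_quiverI)
  show "add_frozen Q b s t = - add_frozen Q b t s" for s t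
    using is_quiver_swap[OF assms, of "the s" "the t"]
    by (cases s; cases t) (simp_all add: add_frozen_def)
qed

lemma mutate_add_frozen:
  assumes "is_quiver Q"
  obtains b' where "mutate (Some k) (add_frozen Q b) = add_frozen (mutate k Q) b'"
proof
  let ?R = "mutate (Some k) (add_frozen Q b)"
  have R: "is_quiver ?R"
    using assms by (intro is_quiver_mutate is_quiver_add_frozen)
  show "?R = add_frozen (mutate k Q) (\<lambda>i. ?R (Some i) None)"
  proof (intro ext)
    show "?R s t = add_frozen (mutate k Q) (\<lambda>i. ?R (Some i) None) s t" for s t
    proof (cases s; cases t)
      fix j
      assume "s = None" "t = Some j"
      then show ?thesis
        using is_quiver_swap[OF R, of None "Some j"] by (simp add: add_frozen_def)
    qed (use is_quiver_diag[OF R, of None] in \<open>simp_all add: mutate_eq add_frozen_def\<close>)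
  qed
qed

lemma mutation_class_add_frozen:
  assumes "R \<in> mutation_class UNIV Q" "is_quiver Q"
  shows "\<exists>b'. add_frozen R b' \<in> mutation_class (range Some) (add_frozen Q b)"
  using assms
proof induction
  case base
  show ?case
    by (rule exI[of _ b]) (rule mutation_class.base)
next
  case (step R k)
  then obtain b' where "add_frozen R b' \<in> mutation_class (range Some) (add_frozen Q b)"
    by blast
  then have "mutate (Some k) (add_frozen R b') \<in> mutation_class (range Some) (add_frozen Q b)"
    by (rule mutation_class.step) simp
  moreover obtain b'' where "mutate (Some k) (add_frozen R b') = add_frozen (mutate k R) b''"
    using mutate_add_frozen[OF is_quiver_mutation_class[OF step.hyps(1) step.prems]] .
  ultimately show ?case
    by metis
qed

subsection \<open>The elliptic quiver of type E8\<close>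

text \<open>The vertices are ordered as \<open>a, b, x1, y2, x2, x3, z2, z3, z4, z5\<close>. The arguments are the
  orientations of the leg edges, named after their outer ends.\<close>

definition E8_matrix :: "int \<Rightarrow> int \<Rightarrow> int \<Rightarrow> int \<Rightarrow> int \<Rightarrow> int list list" where
  "E8_matrix y2 z2 z3 z4 z5 =
    [[0, 2, -1, 0, -1, -1, 0, 0, 0, 0],
     [-2, 0, 1, 0, 1, 1, 0, 0, 0, 0],
     [1, -1, 0, y2, 0, 0, 0, 0, 0, 0],
     [0, 0, - y2, 0, 0, 0, 0, 0, 0, 0],
     [1, -1, 0, 0, 0, 0, 0, 0, 0, 0],
     [1, -1, 0, 0, 0, 0, z2, 0, 0, 0],
     [0, 0, 0, 0, 0, - z2, 0, z3, 0, 0],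
     [0, 0, 0, 0, 0, 0, - z3, 0, z4, 0],
     [0, 0, 0, 0, 0, 0, 0, - z4, 0, z5],
     [0, 0, 0, 0, 0, 0, 0, 0, - z5, 0]]"

text \<open>Mutating the vertices beyond a leg edge one after the other, always at a source, reverses
  that edge and restores the orientation of the edges further out.\<close>

lemma E8_matrix_flip:
  "fold mutate_matrix [3] (E8_matrix (-1) z2 z3 z4 z5) = E8_matrix 1 z2 z3 z4 z5"
  "fold mutate_matrix [6, 7, 8, 9] (E8_matrix y2 (-1) 1 1 1) = E8_matrix y2 1 1 1 1"
  "fold mutate_matrix [7, 8, 9] (E8_matrix y2 z2 (-1) 1 1) = E8_matrix y2 z2 1 1 1"
  "fold mutate_matrix [8, 9] (E8_matrix y2 z2 z3 (-1) 1) = E8_matrix y2 z2 z3 1 1"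
  "fold mutate_matrix [9] (E8_matrix y2 z2 z3 z4 (-1)) = E8_matrix y2 z2 z3 z4 1"
  by (simp_all add: E8_matrix_def mutate_matrix_def)

lemma E8_matrix_orient_outward:
  assumes "\<bar>y2\<bar> = 1" "\<bar>z2\<bar> = 1" "\<bar>z3\<bar> = 1" "\<bar>z4\<bar> = 1" "\<bar>z5\<bar> = 1"
  obtains ks where "set ks \<subseteq> {..<10}"
    "fold mutate_matrix ks (E8_matrix y2 z2 z3 z4 z5) = E8_matrix 1 1 1 1 1"
proof
  have sign: "s = 1 \<or> s = - 1" if "\<bar>s\<bar> = 1" for s :: int
    using that by linarith
  define flip :: "int \<Rightarrow> nat list \<Rightarrow> nat list" where "flip s ks = (if s = 1 then [] else ks)" for s ks
  let ?ks = "flip z5 [9] @ flip z4 [8, 9] @ flip z3 [7, 8, 9] @ flip z2 [6, 7, 8, 9] @ flip y2 [3]"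
  show "set ?ks \<subseteq> {..<10}"
    by (simp add: flip_def)
  have "fold mutate_matrix (flip z5 [9]) (E8_matrix y2 z2 z3 z4 z5) = E8_matrix y2 z2 z3 z4 1"
    "fold mutate_matrix (flip z4 [8, 9]) (E8_matrix y2 z2 z3 z4 1) = E8_matrix y2 z2 z3 1 1"
    "fold mutate_matrix (flip z3 [7, 8, 9]) (E8_matrix y2 z2 z3 1 1) = E8_matrix y2 z2 1 1 1"
    "fold mutate_matrix (flip z2 [6, 7, 8, 9]) (E8_matrix y2 z2 1 1 1) = E8_matrix y2 1 1 1 1"
    "fold mutate_matrix (flip y2 [3]) (E8_matrix y2 1 1 1 1) = E8_matrix 1 1 1 1 1"
    using assms[THEN sign] E8_matrix_flip unfolding flip_def by auto
  then show "fold mutate_matrix ?ks (E8_matrix y2 z2 z3 z4 z5) = E8_matrix 1 1 1 1 1"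
    by simp
qed

text \<open>Found by computer search for a mutation sequence leading to a double arrow whose condition is
  violated by the numbers \<open>-1, 1\<close> at \<open>a, b\<close> and zero elsewhere.\<close>

definition E8_word :: "nat list" where
  "E8_word = [2, 4, 0, 5, 6, 7, 0, 1, 3, 8, 7, 1, 2, 9]"

lemma E8_columns:
  "mutation_columns E8_word (E8_matrix 1 1 1 1 1) =
    [(2, [-1, 1, 0, -1, 0, 0, 0, 0, 0, 0]),
     (4, [-1, 1, 0, 0, 0, 0, 0, 0, 0, 0]),
     (0, [0, 0, -1, 0, -1, 1, 0, 0, 0, 0]),
     (5, [1, 1, -1, 0, -1, 0, -1, 0, 0, 0]),
     (6, [1, 1, 0, 0, 0, -1, 0, -1, 0, 0]),
     (7, [1, 1, 0, 0, 0, 0, -1, 0, -1, 0]),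
     (0, [0, 0, 0, 0, 0, 0, 0, 1, -1, 0]),
     (1, [0, 0, 0, -1, 0, 0, 0, 1, -1, 0]),
     (3, [0, -1, -1, 0, 0, 0, 0, 1, 0, 0]),
     (8, [-1, -1, 0, 0, 0, 0, 0, 1, 0, -1]),
     (7, [0, -1, -1, 1, 0, 0, 1, 0, 1, -1]),
     (1, [0, 0, 0, 0, 0, 0, 1, -1, 0, 0]),
     (2, [0, 0, 0, 0, 0, -1, 1, -1, 1, 0]),
     (9, [0, 0, 0, 1, 0, 0, 1, -1, 0, 0])]"
  by code_simp

lemma E8_double_arrow: "fold mutate_matrix E8_word (E8_matrix 1 1 1 1 1) ! 6 ! 7 = 2"
  by code_simp

definition E8_trace :: "(nat \<Rightarrow> int) \<Rightarrow> (nat \<Rightarrow> int) \<Rightarrow> (nat \<Rightarrow> int) \<Rightarrow> bool" where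
  "E8_trace x y z \<longleftrightarrow> arrow_trace (mutation_columns E8_word (E8_matrix 1 1 1 1 1))
    (map x [0..<10]) (map y [0..<14]) (map z [0..<10])"

lemma E8_trace_equations:
  assumes "E8_trace x y z"
  shows "y 0 = x 2" "y 1 = x 4" "y 2 = x 0 + nprt (y 0) + nprt (y 1)"
    "y 3 = x 5 + pprt (y 2)" "y 4 = x 6 + nprt (y 3)" "y 5 = x 7 + nprt (y 4)"
    "y 6 = - y 2 + pprt (y 3) + pprt (y 4) + pprt (y 5)"
    "y 7 = x 1 + pprt (y 0) + pprt (y 1) + pprt (y 3) + pprt (y 4) + pprt (y 5)"
    "y 8 = x 3 + nprt (y 0) + nprt (y 7)"
    "y 9 = x 8 + nprt (y 5) + nprt (y 6) + nprt (y 7)"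
    "y 10 = - y 5 + pprt (y 6) + pprt (y 7) + pprt (y 8) + pprt (y 9)"
    "y 11 = - y 7 + nprt (y 8) + nprt (y 9) + nprt (y 10)"
    "y 12 = - y 0 + nprt (y 2) + nprt (y 3) + nprt (y 8) + nprt (y 10)"
    "y 13 = x 9 + nprt (y 9) + nprt (y 10)"
    "z 6 = - y 4 + nprt (y 5) + pprt (y 10) + pprt (y 11) + pprt (y 12) + pprt (y 13)"
    "z 7 = - y 10 + nprt (y 11) + nprt (y 12) + nprt (y 13)"
  using assms unfolding E8_trace_def E8_columns
  by (auto simp: mutate_arrows_def upt_rec[of 0] upt_rec[of "Suc 0"] simp flip: numeral_2_eq_2
      simp del: pprt_eq_id nprt_eq_id pprt_eq_0 nprt_eq_0)

lemma E8_trace_signs: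
  assumes trace: "E8_trace x y z" and initial: "x 0 + x 1 = 0" "0 \<le> x 1" and final: "0 \<le> z 7"
  shows "y 0 \<le> 0" "y 1 \<le> 0" "y 2 \<le> 0" "y 3 \<le> 0"
    "y 4 \<le> 0" "y 5 \<le> 0" "y 8 \<le> 0" "y 9 \<le> 0"
    "0 \<le> y 2" "0 \<le> y 5" "0 \<le> y 6" "0 \<le> y 7"
    "0 \<le> y 10" "0 \<le> y 11" "0 \<le> y 12" "0 \<le> y 13"
proof -
  define p n where "p i = pprt (y i)" and "n i = nprt (y i)" for i
  have y: "y i = p i + n i" for i
    unfolding p_def n_def by (rule prts)
  have p: "0 \<le> p 0" "0 \<le> p 1" "0 \<le> p 3" "0 \<le> p 4" "0 \<le> p 5" "0 \<le> p 8" "0 \<le> p 9"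
    and n: "n 0 \<le> 0" "n 1 \<le> 0" "n 2 \<le> 0" "n 5 \<le> 0" "n 11 \<le> 0" "n 12 \<le> 0" "n 13 \<le> 0"
    by (simp_all add: p_def n_def)
  note eqs = E8_trace_equations[OF trace, folded p_def n_def]
  show y2: "y 2 \<le> 0"
    using eqs(3) initial n by linarith
  then have p2: "p 2 = 0"
    by (simp add: p_def)
  show "0 \<le> y 6" "0 \<le> y 7"
    using eqs(7,8) y2 initial p by linarith+
  then have n67: "n 6 = 0" "n 7 = 0"
    by (simp_all add: n_def)
  have y10: "y 10 = x 1 + p 0 + p 1 + 2 * p 3 + 2 * p 4 + p 5 + p 8 + p 9 - n 2 - n 5"
    using eqs(7,8,11) y[of 2] y[of 5] y[of 6] y[of 7] p2 n67 by linarith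
  then show "0 \<le> y 10"
    using initial p n by linarith
  \<comment> \<open>So \<open>y 10\<close> is a sum of nonnegative terms, but \<open>0 \<le> z 7\<close> bounds it by 0.\<close>
  have "p 0 = 0" "p 1 = 0" "p 3 = 0" "p 4 = 0" "p 5 = 0" "p 8 = 0" "p 9 = 0"
    "n 2 = 0" "n 5 = 0" "n 11 = 0" "n 12 = 0" "n 13 = 0"
    using y10 eqs(16) initial final p n by linarith+
  then show "y 0 \<le> 0" "y 1 \<le> 0" "y 3 \<le> 0" "y 4 \<le> 0" "y 5 \<le> 0" "y 8 \<le> 0" "y 9 \<le> 0"
    "0 \<le> y 2" "0 \<le> y 5" "0 \<le> y 11" "0 \<le> y 12" "0 \<le> y 13"
    by (simp_all only: p_def n_def le_zero_iff_zero_pprt zero_le_iff_zero_nprt)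
qed

lemma E8_trace_zero:
  assumes trace: "E8_trace x y z"
    and initial: "x 0 + x 1 = 0" "0 \<le> x 1" and final: "z 6 + z 7 = 0" "0 \<le> z 7"
  shows "\<forall>i < 10. x i = 0"
proof -
  note signs = E8_trace_signs[OF trace initial final(2)]
  note linear = E8_trace_equations[OF trace, unfolded
      signs(1-8)[THEN pprt_eq_0] signs(1-8)[THEN nprt_eq_id]
      signs(9-16)[THEN pprt_eq_id] signs(9-16)[THEN nprt_eq_0]]
  have "x 0 = 0" "x 1 = 0" "x 2 = 0" "x 3 = 0" "x 4 = 0"
    "x 5 = 0" "x 6 = 0" "x 7 = 0" "x 8 = 0" "x 9 = 0"
    using linear signs initial final by linarith+
  then show ?thesis
    by (simp add: numeral_eq_Suc All_less_Suc)
qed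

lemma exchange_matrix_E8_length:
  assumes "exchange_matrix vs Q = E8_matrix y2 z2 z3 z4 z5"
  shows "length vs = 10"
  using arg_cong[OF assms, of length] by (simp add: exchange_matrix_def E8_matrix_def)

lemma E8_trace_mutate_word:
  assumes vs: "distinct vs" and q: "q \<notin> set vs"
    and matrix: "exchange_matrix vs Q = E8_matrix 1 1 1 1 1"
  obtains y where "E8_trace (\<lambda>i. Q (vs ! i) q) y (\<lambda>i. mutate_word vs E8_word Q (vs ! i) q)"
proof -
  have len: "length vs = 10"
    by (rule exchange_matrix_E8_length[OF matrix])
  have "set E8_word \<subseteq> {..<length vs}" "length E8_word = 14"
    by (simp_all add: E8_word_def len)
  then obtain ys where ys: "length ys = 14"
    and trace: "arrow_trace (mutation_columns E8_word (exchange_matrix vs Q))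
      (map (\<lambda>u. Q u q) vs) ys (map (\<lambda>u. mutate_word vs E8_word Q u q) vs)"
    using arrow_trace_mutate_word[OF vs _ q, of E8_word Q] by metis
  have "map f vs = map (\<lambda>i. f (vs ! i)) [0..<10]" for f :: "'a \<Rightarrow> int"
    by (intro nth_equalityI) (simp_all add: len)
  moreover have "map ((!) ys) [0..<14] = ys"
    using map_nth[of ys] unfolding ys .
  ultimately show thesis
    using that[of "(!) ys"] trace unfolding E8_trace_def matrix by simp
qed

lemma E8_outward_isolated:
  assumes Q: "is_quiver Q" and fin: "finite (mutation_class (set vs) Q)"
    and vs: "distinct vs" and q: "q \<notin> set vs"
    and matrix: "exchange_matrix vs Q = E8_matrix 1 1 1 1 1"
    and u: "u \<in> set vs"
  shows "Q u q = 0"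
proof -
  let ?R = "mutate_word vs E8_word Q"
  have len: "length vs = 10"
    by (rule exchange_matrix_E8_length[OF matrix])
  have word: "set E8_word \<subseteq> {..<length vs}"
    by (simp add: E8_word_def len)
  have R: "?R \<in> mutation_class (set vs) Q"
    by (rule mutate_word_in_mutation_class[OF word])
  obtain y where "E8_trace (\<lambda>i. Q (vs ! i) q) y (\<lambda>i. ?R (vs ! i) q)"
    by (rule E8_trace_mutate_word[OF vs q matrix])
  then have "\<forall>i < 10. Q (vs ! i) q = 0"
  proof (rule E8_trace_zero)
    show "Q (vs ! 0) q + Q (vs ! 1) q = 0" "0 \<le> Q (vs ! 1) q"
      by (rule double_arrow_balanced_nth[OF Q fin q, of 0 1]; simp add: len matrix E8_matrix_def)+
    show "?R (vs ! 6) q + ?R (vs ! 7) q = 0" "0 \<le> ?R (vs ! 7) q"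
      by (rule double_arrow_balanced_nth[OF is_quiver_mutation_class[OF R Q]
            finite_mutation_class_trans[OF R fin] q, of 6 7];
          simp add: len exchange_matrix_mutate_word[OF vs word] matrix E8_double_arrow)+
  qed
  then show ?thesis
    using u len by (metis in_set_conv_nth)
qed

proposition E8_isolated:
  assumes Q: "is_quiver Q" and fin: "finite (mutation_class (set vs) Q)"
    and vs: "distinct vs" and q: "q \<notin> set vs"
    and matrix: "exchange_matrix vs Q = E8_matrix y2 z2 z3 z4 z5"
    and signs: "\<bar>y2\<bar> = 1" "\<bar>z2\<bar> = 1" "\<bar>z3\<bar> = 1" "\<bar>z4\<bar> = 1" "\<bar>z5\<bar> = 1"
    and u: "u \<in> set vs"
  shows "Q u q = 0"
proof -
  obtain ks where ks: "set ks \<subseteq> {..<10}"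
    "fold mutate_matrix ks (E8_matrix y2 z2 z3 z4 z5) = E8_matrix 1 1 1 1 1"
    using E8_matrix_orient_outward[OF signs] .
  have word: "set ks \<subseteq> {..<length vs}"
    using ks(1) exchange_matrix_E8_length[OF matrix] by simp
  let ?R = "mutate_word vs ks Q"
  have R: "?R \<in> mutation_class (set vs) Q"
    by (rule mutate_word_in_mutation_class[OF word])
  have "exchange_matrix vs ?R = E8_matrix 1 1 1 1 1"
    by (simp add: exchange_matrix_mutate_word[OF vs word] matrix ks(2))
  then have "?R w q = 0" if "w \<in> set vs" for w
    using that E8_outward_isolated[OF is_quiver_mutation_class[OF R Q]
        finite_mutation_class_trans[OF R fin] vs q] by blast
  then show ?thesis
    using isolated_mutation_class[OF mutation_class_sym[OF R Q] q] u by blast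
qed

lemma is_E8_11_is_quiver: "is_E8_11 Q \<Longrightarrow> is_quiver Q"
  unfolding is_E8_11_def by blast

lemma is_E8_11_exchange_matrix:
  fixes Q :: "'v::finite quiver"
  assumes "is_E8_11 Q"
  obtains vs y2 z2 z3 z4 z5 where "distinct vs" "set vs = UNIV"
    "exchange_matrix vs Q = E8_matrix y2 z2 z3 z4 z5"
    "\<bar>y2\<bar> = 1" "\<bar>z2\<bar> = 1" "\<bar>z3\<bar> = 1" "\<bar>z4\<bar> = 1" "\<bar>z5\<bar> = 1"
proof -
  note Q = is_E8_11_is_quiver[OF assms]
  obtain a b x1 y2 x2 x3 z2 z3 z4 z5 where
    dist: "distinct [a, b, x1, y2, x2, x3, z2, z3, z4, z5]" and
    univ: "UNIV = {a, b, x1, y2, x2, x3, z2, z3, z4, z5}" and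
    arrows: "Q a b = 2" "Q b x1 = 1" "Q x1 a = 1" "Q b x2 = 1" "Q x2 a = 1" "Q b x3 = 1"
      "Q x3 a = 1"
    and signs: "\<bar>Q x1 y2\<bar> = 1" "\<bar>Q x3 z2\<bar> = 1" "\<bar>Q z2 z3\<bar> = 1"
      "\<bar>Q z3 z4\<bar> = 1" "\<bar>Q z4 z5\<bar> = 1"
    and edges: "\<forall>u v. Q u v \<noteq> 0 \<longrightarrow>
      {u, v} \<in> {{a, b}, {b, x1}, {x1, a}, {b, x2}, {x2, a}, {b, x3}, {x3, a},
        {x1, y2}, {x3, z2}, {z2, z3}, {z3, z4}, {z4, z5}}"
    using assms unfolding is_E8_11_def by (elim conjE exE) blast
  have zero: "Q u v = 0"
    if "{u, v} \<notin> {{a, b}, {b, x1}, {x1, a}, {b, x2}, {x2, a}, {b, x3}, {x3, a},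
        {x1, y2}, {x3, z2}, {z2, z3}, {z3, z4}, {z4, z5}}" for u v
    by (rule ccontr) (rule notE[OF that edges[rule_format]])
  note reversed = is_quiver_swap[OF Q, of b a] is_quiver_swap[OF Q, of x1 b]
    is_quiver_swap[OF Q, of a x1] is_quiver_swap[OF Q, of x2 b] is_quiver_swap[OF Q, of a x2]
    is_quiver_swap[OF Q, of x3 b] is_quiver_swap[OF Q, of a x3] is_quiver_swap[OF Q, of y2 x1]
    is_quiver_swap[OF Q, of z2 x3] is_quiver_swap[OF Q, of z3 z2] is_quiver_swap[OF Q, of z4 z3]
    is_quiver_swap[OF Q, of z5 z4]
  show thesis
  proof (rule that)
    show "exchange_matrix [a, b, x1, y2, x2, x3, z2, z3, z4, z5] Q =
        E8_matrix (Q x1 y2) (Q x3 z2) (Q z2 z3) (Q z3 z4) (Q z4 z5)"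
      using dist[simplified]
      by (elim conjE)
        (simp add: exchange_matrix_def E8_matrix_def arrows reversed Q zero doubleton_eq_iff)
  qed (use dist univ signs in simp_all)
qed

proposition is_E8_11_frozen_isolated:
  assumes E8: "is_E8_11 Q" and fin: "finite (mutation_class (range Some) (add_frozen Q b))"
  shows "b i = 0"
proof -
  obtain vs y2 z2 z3 z4 z5 where vs: "distinct vs" "set vs = UNIV"
    and matrix: "exchange_matrix vs Q = E8_matrix y2 z2 z3 z4 z5"
    and signs: "\<bar>y2\<bar> = 1" "\<bar>z2\<bar> = 1" "\<bar>z3\<bar> = 1" "\<bar>z4\<bar> = 1" "\<bar>z5\<bar> = 1"
    using is_E8_11_exchange_matrix[OF E8] .
  have "add_frozen Q b (Some i) None = 0"
  proof (rule E8_isolated[of _ "map Some vs"])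
    show "is_quiver (add_frozen Q b)"
      by (intro is_quiver_add_frozen is_E8_11_is_quiver E8)
    show "exchange_matrix (map Some vs) (add_frozen Q b) = E8_matrix y2 z2 z3 z4 z5"
      by (simp add: matrix[symmetric] exchange_matrix_def add_frozen_def)
  qed (use vs signs fin in \<open>simp_all add: distinct_map\<close>)
  then show ?thesis
    by (simp add: add_frozen_def)
qed

theorem theorem5p3:
  fixes Q0 Q :: "'v::finite quiver"
  assumes "is_E8_11 Q0"
    and "Q \<in> mutation_class UNIV Q0"
  shows "\<not> (\<exists>b :: 'v \<Rightarrow> int. admissible Q b)"
proof
  assume "\<exists>b. admissible Q b"
  then obtain b i where i: "b i \<noteq> 0"
    and fin: "finite (mutation_class (range Some) (add_frozen Q b))"
    unfolding admissible_def by blast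
  note Q0 = is_E8_11_is_quiver[OF assms(1)]
  note Q = is_quiver_mutation_class[OF assms(2) Q0]
  obtain b0 where b0: "add_frozen Q0 b0 \<in> mutation_class (range Some) (add_frozen Q b)"
    using mutation_class_add_frozen[OF mutation_class_sym[OF assms(2) Q0] Q] by blast
  have "b0 j = 0" for j
    by (rule is_E8_11_frozen_isolated[OF assms(1) finite_mutation_class_trans[OF b0 fin]])
  then have "add_frozen Q b (Some i) None = 0"
    by (intro isolated_mutation_class[OF mutation_class_sym[OF b0 is_quiver_add_frozen[OF Q]]])
      (auto simp: add_frozen_def)
  then show False
    using i by (simp add: add_frozen_def)
qed

end
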